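(* Let $\Delta$ be a pure simplicial complex of dimension $d\ge 1$. (a) If $\Delta$ is E-chordal, then $\Delta$ is vertex-chordal. (b) If $\Delta$ is mid-chordal, then $\Delta$ is weakly-vertex-chordal. (c) If $\Delta$ is very-weakly-chordal, then $\Delta$ is weakly-ridge-chordal.
   Context: Simplicial complexes are finite. A vertex labeling of a complex with $n$ vertices is a bijection of its vertices with $[n]$; $\max F$ is the largest label in $F$; the size of a face is its number of vertices. Two faces of the same dimension $k$ are adjacent if their intersection has dimension $k-1$. $\Delta$ is: - E-chordal, if it has a labeling such that for every two facets $F\ne G$ with the same size and same maximum, every subset $H\subseteq F\cup G$ with $|H|=|F|$ is a face of $\Delta$; - mid-chordal, if it has a labeling such that for every two facets $F\neq G$ with the same size and same maximum, $\Delta$ contains every $2$-element subset $e$ of $(F\cup G)\setminus\{\max F\}$ and, for each such $e$, some face $H_e$ with $|H_e|=|F|$ and $e\subseteq H_e\subseteq (F\cup G)\setminus\{\max F\}$; - very-weakly-chordal, if it has a labeling such that for every two adjacent facets $F\ne G$ with the same size and same maximum, $(F\cup G)\setminus\{\max F\}$ is a face of $\Delta$. A $t$-clique of a complex $\Gamma$ is a set $X$ of vertices such that any $k+1\le t+1$ vertices of $X$ span a $k$-face of $\Gamma$. A face of $\Gamma$ is $t$-simplicial if the vertices of its star in $\Gamma$ form a $t$-clique of $\Gamma$. Deleting above a face $F$ of $\Gamma$ means passing to the complex $\operatorname{abdel}(F,\Gamma)$ whose facets are the facets of $\Gamma$ not containing $F$. The empty set has dimension $-1$. For $0\le j<d$,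 a $d$-dimensional complex $\Delta$ is $j$-face-chordal (resp. weakly-$j$-face-chordal) if it can be reduced to a complex of dimension $\le j$ by repeatedly deleting above a $j$-face that is $d$-simplicial (resp. $1$-simplicial) in the current complex (here $d$ is always the dimension of the original $\Delta$). Vertex-chordal means $0$-face-chordal, weakly-vertex-chordal means weakly-$0$-face-chordal, and weakly-ridge-chordal means weakly-$(d-1)$-face-chordal. *)

theory Defs
  imports Main
begin

text \<open>Finite abstract simplicial complexes, given by their set of faces. The void complex \<open>{}\<close>
  is allowed: it is what remains when all facets have been deleted.\<close>

definition simplicial_complex :: "'a set set \<Rightarrow> bool" where
  "simplicial_complex \<Delta> \<longleftrightarrow>
     finite \<Delta> \<and> (\<forall>F\<in>\<Delta>. finite F) \<and> (\<forall>F\<in>\<Delta>. \<forall>G. G \<subseteq> F \<longrightarrow> G \<in> \<Delta>)"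

definition vertices :: "'a set set \<Rightarrow> 'a set" where
  "vertices \<Delta> = \<Union>\<Delta>"

definition face_dim :: "'a set \<Rightarrow> int" where
  "face_dim F = int (card F) - 1"

text \<open>Both \<open>{}\<close> and \<open>{{}}\<close> get dimension \<open>-1\<close>.\<close>

definition complex_dim :: "'a set set \<Rightarrow> int" where
  "complex_dim \<Delta> = Max (insert (- 1) (face_dim ` \<Delta>))"

definition facet :: "'a set set \<Rightarrow> 'a set \<Rightarrow> bool" where
  "facet \<Delta> F \<longleftrightarrow> F \<in> \<Delta> \<and> (\<forall>G\<in>\<Delta>. F \<subseteq> G \<longrightarrow> G = F)"

definition pure :: "'a set set \<Rightarrow> bool" where
  "pure \<Delta> \<longleftrightarrow> (\<forall>F. facet \<Delta> F \<longrightarrow> face_dim F = complex_dim \<Delta>)"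

definition adjacent :: "'a set \<Rightarrow> 'a set \<Rightarrow> bool" where
  "adjacent F G \<longleftrightarrow> face_dim F = face_dim G \<and> face_dim (F \<inter> G) = face_dim F - 1"

definition labeling :: "'a set set \<Rightarrow> ('a \<Rightarrow> nat) \<Rightarrow> bool" where
  "labeling \<Delta> l \<longleftrightarrow> bij_betw l (vertices \<Delta>) {1..card (vertices \<Delta>)}"

definition max_label :: "('a \<Rightarrow> nat) \<Rightarrow> 'a set \<Rightarrow> nat" where
  "max_label l F = Max (l ` F)"

text \<open>The set \<open>(F \<union> G) - {max F}\<close>, where the vertices are identified with their labels.\<close>

definition union_minus_max :: "('a \<Rightarrow> nat) \<Rightarrow> 'a set \<Rightarrow> 'a set \<Rightarrow> 'a set" where
  "union_minus_max l F G = {v \<in> F \<union> G. l v \<noteq> max_label l F}"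

definition E_chordal :: "'a set set \<Rightarrow> bool" where
  "E_chordal \<Delta> \<longleftrightarrow>
     (\<exists>l. labeling \<Delta> l \<and>
       (\<forall>F G. facet \<Delta> F \<and> facet \<Delta> G \<and> F \<noteq> G \<and> card F = card G \<and>
              max_label l F = max_label l G \<longrightarrow>
          (\<forall>H. H \<subseteq> F \<union> G \<and> card H = card F \<longrightarrow> H \<in> \<Delta>)))"

definition mid_chordal :: "'a set set \<Rightarrow> bool" where
  "mid_chordal \<Delta> \<longleftrightarrow>
     (\<exists>l. labeling \<Delta> l \<and>
       (\<forall>F G. facet \<Delta> F \<and> facet \<Delta> G \<and> F \<noteq> G \<and> card F = card G \<and>
              max_label l F = max_label l G \<longrightarrow>
          (\<forall>e. e \<subseteq> union_minus_max l F G \<and> card e = 2 \<longrightarrow>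
             e \<in> \<Delta> \<and>
             (\<exists>H\<in>\<Delta>. card H = card F \<and> e \<subseteq> H \<and> H \<subseteq> union_minus_max l F G))))"

definition very_weakly_chordal :: "'a set set \<Rightarrow> bool" where
  "very_weakly_chordal \<Delta> \<longleftrightarrow>
     (\<exists>l. labeling \<Delta> l \<and>
       (\<forall>F G. facet \<Delta> F \<and> facet \<Delta> G \<and> adjacent F G \<and> F \<noteq> G \<and> card F = card G \<and>
              max_label l F = max_label l G \<longrightarrow>
          union_minus_max l F G \<in> \<Delta>))"

definition clique :: "int \<Rightarrow> 'a set set \<Rightarrow> 'a set \<Rightarrow> bool" where
  "clique t \<Gamma> X \<longleftrightarrow>
     X \<subseteq> vertices \<Gamma> \<and> (\<forall>Y. Y \<subseteq> X \<and> Y \<noteq> {} \<and> face_dim Y \<le> t \<longrightarrow> Y \<in> \<Gamma>)"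

definition star :: "'a set set \<Rightarrow> 'a set \<Rightarrow> 'a set set" where
  "star \<Gamma> F = {G \<in> \<Gamma>. F \<union> G \<in> \<Gamma>}"

definition simplicial :: "int \<Rightarrow> 'a set set \<Rightarrow> 'a set \<Rightarrow> bool" where
  "simplicial t \<Gamma> F \<longleftrightarrow> F \<in> \<Gamma> \<and> clique t \<Gamma> (vertices (star \<Gamma> F))"

definition abdel :: "'a set \<Rightarrow> 'a set set \<Rightarrow> 'a set set" where
  "abdel F \<Gamma> = {H. \<exists>G. facet \<Gamma> G \<and> \<not> F \<subseteq> G \<and> H \<subseteq> G}"

definition deletion_step :: "int \<Rightarrow> int \<Rightarrow> 'a set set \<Rightarrow> 'a set set \<Rightarrow> bool" where
  "deletion_step j t \<Gamma> \<Gamma>' \<longleftrightarrow>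
     (\<exists>F. face_dim F = j \<and> simplicial t \<Gamma> F \<and> \<Gamma>' = abdel F \<Gamma>)"

text \<open>In \<open>face_chordal\<close> the simpliciality parameter is the dimension of the original complex
  throughout the whole reduction.\<close>

definition face_chordal :: "int \<Rightarrow> 'a set set \<Rightarrow> bool" where
  "face_chordal j \<Delta> \<longleftrightarrow>
     0 \<le> j \<and> j < complex_dim \<Delta> \<and>
     (\<exists>\<Gamma>. (deletion_step j (complex_dim \<Delta>))\<^sup>*\<^sup>* \<Delta> \<Gamma> \<and> complex_dim \<Gamma> \<le> j)"

definition weakly_face_chordal :: "int \<Rightarrow> 'a set set \<Rightarrow> bool" where
  "weakly_face_chordal j \<Delta> \<longleftrightarrow>
     0 \<le> j \<and> j < complex_dim \<Delta> \<and>
     (\<exists>\<Gamma>. (deletion_step j 1)\<^sup>*\<^sup>* \<Delta> \<Gamma> \<and> complex_dim \<Gamma> \<le> j)"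

definition vertex_chordal :: "'a set set \<Rightarrow> bool" where
  "vertex_chordal \<Delta> \<longleftrightarrow> face_chordal 0 \<Delta>"

definition weakly_vertex_chordal :: "'a set set \<Rightarrow> bool" where
  "weakly_vertex_chordal \<Delta> \<longleftrightarrow> weakly_face_chordal 0 \<Delta>"

definition weakly_ridge_chordal :: "'a set set \<Rightarrow> bool" where
  "weakly_ridge_chordal \<Delta> \<longleftrightarrow> weakly_face_chordal (complex_dim \<Delta> - 1) \<Delta>"

end

theory Submission
  imports Defs
begin

text \<open>The facets of a pure complex are processed from the largest label downwards. Let \<open>v\<close> be
  the vertex of largest label in the current complex; then all facets through \<open>v\<close> have the same
  maximum, so the chordality hypothesis applies to any two of them. In the first two cases it says
  that \<open>v\<close> is simplicial; in the third, that any ridge containing \<open>v\<close> is \<open>1\<close>-simplicial. The faces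
  that the hypothesis provides outside of the star of \<open>v\<close> have a smaller maximum, and hence have
  not been deleted yet. Deletion thus continues until no facet is left.\<close>

section \<open>Complexes given by their facets, and iterated deletion\<close>

text \<open>Deletion acts on facets only, so each complex of the reduction is encoded by its family
  of facets. The empty family yields the void complex, not \<open>{{}}\<close>.\<close>

definition generated :: "'a set set \<Rightarrow> 'a set set" where
  "generated \<F> = {H. \<exists>G\<in>\<F>. H \<subseteq> G}"

lemma generated_empty [simp]: "generated {} = {}"
  by (simp add: generated_def)

text \<open>Sets of equal finite size are never properly contained in one another, so every member
  of the family stays maximal.\<close>

lemma facet_generated:
  assumes "\<And>F. F \<in> \<F> \<Longrightarrow> finite F \<and> card F = s"
  shows "facet (generated \<F>) F \<longleftrightarrow> F \<in> \<F>"
proof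
  assume "facet (generated \<F>) F"
  then show "F \<in> \<F>"
    unfolding facet_def generated_def by blast
next
  assume F: "F \<in> \<F>"
  have "G = F" if "H \<in> \<F>" "G \<subseteq> H" "F \<subseteq> G" for G H
  proof -
    have "F = H"
      using assms[OF F] assms[OF that(1)] that by (intro card_subset_eq) auto
    with that show ?thesis by blast
  qed
  with F show "facet (generated \<F>) F"
    unfolding facet_def generated_def by blast
qed

text \<open>The surviving facets are again uniform of size \<open>s\<close>, so this description
  persists from one deletion to the next.\<close>

lemma abdel_generated:
  assumes "\<And>F. F \<in> \<F> \<Longrightarrow> finite F \<and> card F = s"
  shows "abdel R (generated \<F>) = generated {G \<in> \<F>. \<not> R \<subseteq> G}"
  using facet_generated[OF assms] unfolding abdel_def by (auto simp: generated_def)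

lemma vertices_star_generated:
  "vertices (star (generated \<F>) R) = \<Union>{G \<in> \<F>. R \<subseteq> G}"
  unfolding vertices_def star_def generated_def by blast

lemma simplicial_generatedI:
  assumes "G \<in> \<F>" "R \<subseteq> G"
    and "\<And>Y. \<lbrakk>Y \<subseteq> \<Union>{G \<in> \<F>. R \<subseteq> G}; Y \<noteq> {}; int (card Y) \<le> t + 1\<rbrakk> \<Longrightarrow> \<exists>G\<in>\<F>. Y \<subseteq> G"
  shows "simplicial t (generated \<F>) R"
  unfolding simplicial_def clique_def vertices_star_generated
proof (intro conjI allI impI)
  show "R \<in> generated \<F>" using assms(1,2) by (auto simp: generated_def)
  show "\<Union>{G \<in> \<F>. R \<subseteq> G} \<subseteq> vertices (generated \<F>)"
    by (auto simp: vertices_def generated_def)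
  show "Y \<in> generated \<F>"
    if "Y \<subseteq> \<Union>{G \<in> \<F>. R \<subseteq> G} \<and> Y \<noteq> {} \<and> face_dim Y \<le> t" for Y
    using assms(3)[of Y] that by (auto simp: generated_def face_dim_def)
qed

text \<open>A simplicial \<open>R\<close> is a face, hence lies in some facet; each deletion
  therefore removes at least one facet and the process ends. \<open>P\<close> is the invariant that
  a step may assume and has to restore.\<close>

lemma generated_reduces_to_void:
  assumes "finite \<F>" "P \<F>" "\<And>F. F \<in> \<F> \<Longrightarrow> finite F \<and> card F = s"
    and step: "\<And>\<G>. \<lbrakk>P \<G>; \<G> \<noteq> {}\<rbrakk> \<Longrightarrow>
      \<exists>R. face_dim R = j \<and> simplicial t (generated \<G>) R \<and> P {G \<in> \<G>. \<not> R \<subseteq> G}"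
  shows "(deletion_step j t)\<^sup>*\<^sup>* (generated \<F>) {}"
  using assms(1-3)
proof (induction \<F> rule: finite_psubset_induct)
  case (psubset \<F>)
  show ?case
  proof (cases "\<F> = {}")
    case False
    obtain R where R: "face_dim R = j" "simplicial t (generated \<F>) R" "P {G \<in> \<F>. \<not> R \<subseteq> G}"
      using step[OF psubset.prems(1) False] by blast
    from R(2) obtain G where "G \<in> \<F>" "R \<subseteq> G"
      by (auto simp: simplicial_def generated_def)
    then have "{G \<in> \<F>. \<not> R \<subseteq> G} \<subset> \<F>" by blast
    then have "(deletion_step j t)\<^sup>*\<^sup>* (generated {G \<in> \<F>. \<not> R \<subseteq> G}) {}"
      using psubset.IH R(3) psubset.prems(2) by blast
    moreover have "deletion_step j t (generated \<F>) (generated {G \<in> \<F>. \<not> R \<subseteq> G})"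
      using R abdel_generated[OF psubset.prems(2)] unfolding deletion_step_def by metis
    ultimately show ?thesis by (rule converse_rtranclp_into_rtranclp[rotated])
  qed simp
qed

section \<open>Labeled uniform families and the vertex of largest label\<close>

text \<open>\<open>\<F>\<^sub>0\<close> stands for the facets of the original complex of dimension d
  and \<open>s\<close> for d + 1; the condition d \<ge> 1 becomes
  \<open>two_le_size\<close>.\<close>

locale labeled_uniform_family =
  fixes \<F>\<^sub>0 :: "'a set set" and s :: nat and l :: "'a \<Rightarrow> nat"
  assumes finite_family: "finite \<F>\<^sub>0"
    and uniform: "F \<in> \<F>\<^sub>0 \<Longrightarrow> finite F \<and> card F = s"
    and two_le_size: "2 \<le> s"
    and inj_label: "inj_on l (\<Union>\<F>\<^sub>0)"
begin

text \<open>The invariant of the reduction. A vertex deletion removes all facets with the largest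
  maximum at once, which allows \<open>r\<close> to be \<le>. A ridge deletion may remove only some
  of them, so there \<open>r\<close> must be <.\<close>

definition label_closed :: "(nat \<Rightarrow> nat \<Rightarrow> bool) \<Rightarrow> 'a set set \<Rightarrow> bool" where
  "label_closed r \<F> \<longleftrightarrow> \<F> \<subseteq> \<F>\<^sub>0 \<and>
     (\<forall>F\<in>\<F>. \<forall>G\<in>\<F>\<^sub>0. r (max_label l G) (max_label l F) \<longrightarrow> G \<in> \<F>)"

definition top_vertex :: "'a set set \<Rightarrow> 'a \<Rightarrow> bool" where
  "top_vertex \<F> v \<longleftrightarrow> \<F> \<subseteq> \<F>\<^sub>0 \<and> v \<in> \<Union>\<F> \<and> (\<forall>x\<in>\<Union>\<F>. l x \<le> l v)"

lemma label_closed_le_imp_less: "label_closed (\<le>) \<F> \<Longrightarrow> label_closed (<) \<F>"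
  unfolding label_closed_def by (meson less_imp_le)

lemma top_vertex_exists:
  assumes "\<F> \<subseteq> \<F>\<^sub>0" "\<F> \<noteq> {}"
  obtains v where "top_vertex \<F> v"
proof -
  have fin: "finite (\<Union>\<F>)"
    using assms(1) finite_family uniform by (meson finite_Union finite_subset subsetD)
  obtain F where "F \<in> \<F>" using assms(2) by blast
  with assms(1) have "F \<noteq> {}" using uniform two_le_size by fastforce
  with \<open>F \<in> \<F>\<close> have "l ` \<Union>\<F> \<noteq> {}" by blast
  then have "Max (l ` \<Union>\<F>) \<in> l ` \<Union>\<F>" using fin by (intro Max_in) auto
  then obtain v where "v \<in> \<Union>\<F>" "l v = Max (l ` \<Union>\<F>)" by (metis imageE)
  then have "top_vertex \<F> v"
    using assms(1) fin by (auto simp: top_vertex_def intro!: Max_ge)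
  with that show ?thesis .
qed

lemma max_label_in:
  assumes "F \<in> \<F>\<^sub>0"
  obtains x where "x \<in> F" "l x = max_label l F"
proof -
  have "finite F" "F \<noteq> {}" using uniform[OF assms] two_le_size by auto
  then have "Max (l ` F) \<in> l ` F" by (intro Max_in) auto
  with that show ?thesis by (auto simp: max_label_def)
qed

lemma label_le_max_label: "F \<in> \<F>\<^sub>0 \<Longrightarrow> x \<in> F \<Longrightarrow> l x \<le> max_label l F"
  unfolding max_label_def using uniform by (intro Max_ge) auto

lemma top_vertex_inj:
  assumes "top_vertex \<F> v" "x \<in> \<Union>\<F>" "l v \<le> l x"
  shows "x = v"
proof -
  have "l x = l v" "x \<in> \<Union>\<F>\<^sub>0" "v \<in> \<Union>\<F>\<^sub>0"
    using assms unfolding top_vertex_def by (auto intro: antisym)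
  then show ?thesis using inj_label by (auto dest: inj_onD)
qed

lemma max_label_le_top:
  assumes "top_vertex \<F> v" "F \<in> \<F>\<^sub>0" "F \<subseteq> \<Union>\<F>"
  shows "max_label l F \<le> l v"
  using max_label_in[OF assms(2)] assms unfolding top_vertex_def by (metis subsetD)

lemma max_label_eq_top:
  assumes "top_vertex \<F> v" "F \<in> \<F>\<^sub>0" "F \<subseteq> \<Union>\<F>" "v \<in> F"
  shows "max_label l F = l v"
  using max_label_le_top[OF assms(1-3)] label_le_max_label[OF assms(2,4)] by simp

lemma max_label_less_top:
  assumes "top_vertex \<F> v" "F \<in> \<F>\<^sub>0" "F \<subseteq> \<Union>\<F>" "v \<notin> F"
  shows "max_label l F < l v"
  using max_label_in[OF assms(2)] top_vertex_inj[OF assms(1)] assms(3,4)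
  by (metis linorder_not_le subsetD)

lemma union_minus_max_top:
  assumes "top_vertex \<F> v" "F \<in> \<F>" "v \<in> F" "G \<in> \<F>"
  shows "union_minus_max l F G = F \<union> G - {v}"
proof -
  have "max_label l F = l v"
    using assms by (intro max_label_eq_top) (auto simp: top_vertex_def)
  moreover have "x = v" if "x \<in> F \<union> G" "l x = l v" for x
    using assms(2,4) that by (intro top_vertex_inj[OF assms(1)]) auto
  ultimately show ?thesis
    unfolding union_minus_max_def by auto
qed

text \<open>Some remaining facet contains \<open>v\<close> and has maximum \<open>l v\<close>. As
  \<open>H\<close> avoids \<open>v\<close>, its maximum is strictly smaller, so the strict invariant
  already shows that \<open>H\<close> has survived.\<close>

lemma label_closed_top:
  assumes "label_closed (<) \<F>" "top_vertex \<F> v" "H \<in> \<F>\<^sub>0" "H \<subseteq> \<Union>\<F>" "v \<notin> H"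
  shows "H \<in> \<F>"
proof -
  obtain F where "F \<in> \<F>" "v \<in> F" using assms(2) by (auto simp: top_vertex_def)
  then have "max_label l F = l v"
    using assms(2) by (intro max_label_eq_top) (auto simp: top_vertex_def)
  then show ?thesis
    using max_label_less_top[OF assms(2-5)] assms(1,3) \<open>F \<in> \<F>\<close> by (auto simp: label_closed_def)
qed

text \<open>Here \<open>H\<close> may contain \<open>v\<close> and so have maximum
  \<open>l v\<close> itself, which is why the non-strict invariant is assumed.\<close>

lemma label_closed_le_top:
  assumes "label_closed (\<le>) \<F>" "top_vertex \<F> v" "H \<in> \<F>\<^sub>0" "H \<subseteq> \<Union>\<F>"
  shows "H \<in> \<F>"
proof -
  obtain F where "F \<in> \<F>" "v \<in> F" using assms(2) by (auto simp: top_vertex_def)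
  then have "max_label l F = l v"
    using assms(2) by (intro max_label_eq_top) (auto simp: top_vertex_def)
  then show ?thesis
    using max_label_le_top[OF assms(2-4)] assms(1,3) \<open>F \<in> \<F>\<close> by (auto simp: label_closed_def)
qed

text \<open>A facet that survives avoids \<open>v\<close>, so its maximum is below
  \<open>l v\<close>; no facet with a maximum at most as large can contain \<open>v\<close>.\<close>

lemma label_closed_delete_vertex:
  assumes "label_closed (\<le>) \<F>" "top_vertex \<F> v"
  shows "label_closed (\<le>) {G \<in> \<F>. \<not> {v} \<subseteq> G}"
  unfolding label_closed_def
proof (intro conjI ballI impI)
  show "{G \<in> \<F>. \<not> {v} \<subseteq> G} \<subseteq> \<F>\<^sub>0" using assms(1) by (auto simp: label_closed_def)
  fix F G
  assume F: "F \<in> {G \<in> \<F>. \<not> {v} \<subseteq> G}" and G: "G \<in> \<F>\<^sub>0" "max_label l G \<le> max_label l F"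
  then have "G \<in> \<F>" using assms(1) by (auto simp: label_closed_def)
  moreover have "max_label l F < l v"
    using F assms(1) by (intro max_label_less_top[OF assms(2)]) (auto simp: label_closed_def)
  then have "v \<notin> G" using G label_le_max_label[OF G(1)] by fastforce
  ultimately show "G \<in> {G \<in> \<F>. \<not> {v} \<subseteq> G}" by blast
qed

text \<open>A surviving facet may still contain \<open>v\<close>, so its maximum is only bounded by
  \<open>l v\<close>. The strict comparison nevertheless keeps \<open>v\<close>, and with it
  \<open>R\<close>, out of \<open>G\<close>.\<close>

lemma label_closed_delete_face:
  assumes "label_closed (<) \<F>" "top_vertex \<F> v" "v \<in> R"
  shows "label_closed (<) {G \<in> \<F>. \<not> R \<subseteq> G}"
  unfolding label_closed_def
proof (intro conjI ballI impI)
  show "{G \<in> \<F>. \<not> R \<subseteq> G} \<subseteq> \<F>\<^sub>0" using assms(1) by (auto simp: label_closed_def)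
  fix F G
  assume F: "F \<in> {G \<in> \<F>. \<not> R \<subseteq> G}" and G: "G \<in> \<F>\<^sub>0" "max_label l G < max_label l F"
  then have "G \<in> \<F>" using assms(1) by (auto simp: label_closed_def)
  moreover have "max_label l F \<le> l v"
    using F assms(1) by (intro max_label_le_top[OF assms(2)]) (auto simp: label_closed_def)
  then have "v \<notin> G" using G label_le_max_label[OF G(1)] by fastforce
  ultimately show "G \<in> {G \<in> \<F>. \<not> R \<subseteq> G}" using assms(3) by blast
qed

section \<open>Extending faces at the top vertex: the E-chordal case\<close>

text \<open>The set \<open>Y\<close> is absorbed one vertex at a time: a facet \<open>A\<close>
  holding \<open>v\<close> and the earlier vertices is exchanged for one inside
  \<open>A \<union> B\<close>, where \<open>B\<close> holds \<open>v\<close> and the new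
  vertex.\<close>

lemma E_chordal_extend:
  assumes closed: "\<And>F G H. \<lbrakk>F \<in> \<F>; G \<in> \<F>; v \<in> F; v \<in> G; F \<noteq> G; H \<subseteq> F \<union> G; card H = s\<rbrakk> \<Longrightarrow> H \<in> \<F>"
    and "\<F> \<subseteq> \<F>\<^sub>0" "F \<in> \<F>" "v \<in> F" "finite Y" "Y \<subseteq> \<Union>{G \<in> \<F>. v \<in> G}" "card (insert v Y) \<le> s"
  shows "\<exists>G\<in>\<F>. v \<in> G \<and> Y \<subseteq> G"
  using assms(5-7)
proof (induction Y)
  case empty
  with assms(3,4) show ?case by blast
next
  case (insert y Y)
  have "card (insert v Y) \<le> card (insert v (insert y Y))"
    using insert.hyps by (intro card_mono) auto
  with insert obtain A where A: "A \<in> \<F>" "v \<in> A" "Y \<subseteq> A" by auto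
  obtain B where B: "B \<in> \<F>" "v \<in> B" "y \<in> B" using insert.prems by auto
  have fin: "finite A" "finite B" and cA: "card A = s" using A B assms(2) uniform by auto
  show ?case
  proof (cases "A = B")
    case False
    \<comment> \<open>The union has room for a set of size exactly \<open>s\<close> around the
      vertices to be covered, and \<open>closed\<close> makes any such set a facet.\<close>
    have "s \<le> card (A \<union> B)" using fin cA card_mono[of "A \<union> B" A] by simp
    then obtain C where C: "insert v (insert y Y) \<subseteq> C" "C \<subseteq> A \<union> B" "card C = s"
      using exists_subset_between[of "insert v (insert y Y)" s "A \<union> B"] insert.prems A B fin
      by auto
    then have "C \<in> \<F>" using closed[OF A(1) B(1) A(2) B(2) False] by blast
    with C show ?thesis by blast
  qed (use A B in blast)
qed

text \<open>The top vertex \<open>v\<close> is deleted. \<open>E_chordal_extend\<close> covers every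
  \<open>Y\<close> that fits with \<open>v\<close> into \<open>s\<close> vertices; only sets of full
  size \<open>s\<close> that avoid \<open>v\<close> need another argument.\<close>

lemma E_chordal_step:
  assumes lc: "label_closed (\<le>) \<F>" and "\<F> \<noteq> {}"
    and chordal: "\<And>F G H. \<lbrakk>F \<in> \<F>\<^sub>0; G \<in> \<F>\<^sub>0; F \<noteq> G; max_label l F = max_label l G;
      H \<subseteq> F \<union> G; card H = s\<rbrakk> \<Longrightarrow> H \<in> \<F>\<^sub>0"
  shows "\<exists>R. face_dim R = 0 \<and> simplicial (int s - 1) (generated \<F>) R \<and>
    label_closed (\<le>) {G \<in> \<F>. \<not> R \<subseteq> G}"
proof -
  have sub: "\<F> \<subseteq> \<F>\<^sub>0" using lc by (simp add: label_closed_def)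
  obtain v where v: "top_vertex \<F> v" using top_vertex_exists[OF sub assms(2)] .
  then obtain F where F: "F \<in> \<F>" "v \<in> F" by (auto simp: top_vertex_def)
  have closed: "H \<in> \<F>"
    if "F \<in> \<F>" "G \<in> \<F>" "v \<in> F" "v \<in> G" "F \<noteq> G" "H \<subseteq> F \<union> G" "card H = s" for F G H
  proof (rule label_closed_le_top[OF lc v])
    have "max_label l F = l v" "max_label l G = l v"
      using that sub by (auto intro!: max_label_eq_top[OF v])
    then have "max_label l F = max_label l G" by simp
    moreover have "F \<in> \<F>\<^sub>0" "G \<in> \<F>\<^sub>0" using that sub by auto
    ultimately show "H \<in> \<F>\<^sub>0" using chordal that by blast
    show "H \<subseteq> \<Union>\<F>" using that by blast
  qed
  have extend: "\<exists>G\<in>\<F>. v \<in> G \<and> Y \<subseteq> G"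
    if "finite Y" "Y \<subseteq> \<Union>{G \<in> \<F>. v \<in> G}" "card (insert v Y) \<le> s" for Y
    by (rule E_chordal_extend[OF _ sub F that]) (rule closed)
  have "simplicial (int s - 1) (generated \<F>) {v}"
  proof (rule simplicial_generatedI)
    show "F \<in> \<F>" "{v} \<subseteq> F" using F by auto
    fix Y assume Y: "Y \<subseteq> \<Union>{G \<in> \<F>. {v} \<subseteq> G}" "Y \<noteq> {}" "int (card Y) \<le> int s - 1 + 1"
    have fin: "finite Y"
      using Y(1) sub uniform finite_family finite_subset[of Y "\<Union>\<F>\<^sub>0"] by fastforce
    show "\<exists>G\<in>\<F>. Y \<subseteq> G"
    proof (cases "card (insert v Y) \<le> s")
      case True
      with extend[OF fin] Y(1) show ?thesis by auto
    next
      case False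
      with Y fin have vY: "v \<notin> Y" "card Y = s" by (auto simp: insert_absorb card_insert_if split: if_splits)
      then obtain y z where yz: "y \<in> Y" "z \<in> Y" "y \<noteq> z"
        using two_le_size fin by (metis One_nat_def card_le_Suc0_iff_eq not_less_eq_eq numeral_2_eq_2)
      \<comment> \<open>Leaving out one element of \<open>Y\<close> makes room for \<open>v\<close>
        within size \<open>s\<close>.\<close>
      have part: "\<exists>G\<in>\<F>. v \<in> G \<and> Y - {x} \<subseteq> G" if "x \<in> Y" for x
        using that fin Y(1) vY two_le_size by (intro extend) (auto simp: card_insert_if)
      obtain A B where AB: "A \<in> \<F>" "v \<in> A" "Y - {y} \<subseteq> A" "B \<in> \<F>" "v \<in> B" "Y - {z} \<subseteq> B"
        using part yz by meson
      \<comment> \<open>Since \<open>y\<close> and \<open>z\<close> differ, each is covered by one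
        of the two facets. If these are distinct, \<open>closed\<close> makes \<open>Y\<close>
        itself a facet.\<close>
      with yz have "Y \<subseteq> A \<union> B" by blast
      with AB closed[of A B Y] vY(2) show ?thesis by (cases "A = B") auto
    qed
  qed
  then show ?thesis
    using label_closed_delete_vertex[OF lc v] by (intro exI[of _ "{v}"]) (auto simp: face_dim_def)
qed

section \<open>1-simplicial faces: the mid-chordal and very weakly chordal cases\<close>

text \<open>The elements \<open>a\<close> and \<open>b\<close> may coincide, so singletons and pairs
  are treated together.\<close>

lemma pair_cases:
  assumes "Y \<noteq> {}" "int (card Y) \<le> 1 + 1" "finite Y"
  obtains a b where "Y = {a, b}"
proof -
  have "card Y = 1 \<or> card Y = 2" using assms by (cases "card Y") auto
  with that show ?thesis by (metis card_1_singletonE card_2_iff insert_absorb2)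
qed

text \<open>If \<open>a\<close> lies in \<open>G\<close> or \<open>b\<close> in \<open>F\<close>,
  one of the two facets already contains both; this includes \<open>a = b\<close>. Only pairs
  separated by the two facets remain.\<close>

lemma one_simplicialI:
  assumes "\<F> \<subseteq> \<F>\<^sub>0" "F \<in> \<F>" "R \<subseteq> F"
    and pair: "\<And>a b F G. \<lbrakk>F \<in> \<F>; G \<in> \<F>; R \<subseteq> F; R \<subseteq> G; a \<in> F; b \<in> G; a \<notin> G; b \<notin> F\<rbrakk> \<Longrightarrow>
      \<exists>H\<in>\<F>. {a, b} \<subseteq> H"
  shows "simplicial 1 (generated \<F>) R"
proof (rule simplicial_generatedI[OF assms(2,3)])
  fix Y assume Y: "Y \<subseteq> \<Union>{G \<in> \<F>. R \<subseteq> G}" "Y \<noteq> {}" "int (card Y) \<le> 1 + 1"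
  have "finite Y"
    using Y(1) assms(1) uniform finite_family finite_subset[of Y "\<Union>\<F>\<^sub>0"] by fastforce
  then obtain a b where ab: "Y = {a, b}" using pair_cases Y(2,3) by metis
  with Y(1) have "a \<in> \<Union>{G \<in> \<F>. R \<subseteq> G}" "b \<in> \<Union>{G \<in> \<F>. R \<subseteq> G}" by auto
  then obtain F G where FG: "F \<in> \<F>" "R \<subseteq> F" "a \<in> F" "G \<in> \<F>" "R \<subseteq> G" "b \<in> G"
    by auto
  then show "\<exists>H\<in>\<F>. Y \<subseteq> H"
    using pair[of F G a b] ab by (cases "a \<in> G \<or> b \<in> F") auto
qed

text \<open>A separated pair \<open>a\<close>, \<open>b\<close> avoids \<open>v\<close>, which lies
  in both facets. The facet that the hypothesis provides for this pair avoids \<open>v\<close> too,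
  so it has not been deleted.\<close>

lemma mid_chordal_step:
  assumes lc: "label_closed (\<le>) \<F>" and "\<F> \<noteq> {}"
    and chordal: "\<And>F G e. \<lbrakk>F \<in> \<F>\<^sub>0; G \<in> \<F>\<^sub>0; F \<noteq> G; max_label l F = max_label l G;
      e \<subseteq> union_minus_max l F G; card e = 2\<rbrakk> \<Longrightarrow>
      \<exists>H\<in>\<F>\<^sub>0. e \<subseteq> H \<and> H \<subseteq> union_minus_max l F G"
  shows "\<exists>R. face_dim R = 0 \<and> simplicial 1 (generated \<F>) R \<and>
    label_closed (\<le>) {G \<in> \<F>. \<not> R \<subseteq> G}"
proof -
  have sub: "\<F> \<subseteq> \<F>\<^sub>0" using lc by (simp add: label_closed_def)
  obtain v where v: "top_vertex \<F> v" using top_vertex_exists[OF sub assms(2)] .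
  then obtain F\<^sub>v where F: "F\<^sub>v \<in> \<F>" "v \<in> F\<^sub>v" by (auto simp: top_vertex_def)
  have "simplicial 1 (generated \<F>) {v}"
  proof (rule one_simplicialI[OF sub F(1)])
    fix a b F G
    assume FG: "F \<in> \<F>" "G \<in> \<F>" "{v} \<subseteq> F" "{v} \<subseteq> G" "a \<in> F" "b \<in> G" "a \<notin> G" "b \<notin> F"
    have eq: "union_minus_max l F G = F \<union> G - {v}"
      using FG by (intro union_minus_max_top[OF v]) auto
    have "max_label l F = l v" "max_label l G = l v"
      using FG sub by (auto intro!: max_label_eq_top[OF v])
    moreover have "a \<noteq> b" using FG by blast
    then have "{a, b} \<subseteq> F \<union> G - {v}" "card {a, b} = 2" using FG by auto
    ultimately obtain H where H: "H \<in> \<F>\<^sub>0" "{a, b} \<subseteq> H" "H \<subseteq> F \<union> G - {v}"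
      using chordal[of F G "{a, b}"] FG sub unfolding eq by (metis subsetD)
    then have "H \<in> \<F>"
      using label_closed_top[OF label_closed_le_imp_less[OF lc] v, of H] FG by blast
    with H show "\<exists>H\<in>\<F>. {a, b} \<subseteq> H" by blast
  qed (use F in auto)
  then show ?thesis
    using label_closed_delete_vertex[OF lc v] by (intro exI[of _ "{v}"]) (auto simp: face_dim_def)
qed

text \<open>\<open>R\<close> is any ridge through \<open>v\<close>. Distinct facets over
  \<open>R\<close> add one vertex each, so they are adjacent, and their union without
  \<open>v\<close> is a facet that joins the two added vertices.\<close>

lemma very_weakly_chordal_step:
  assumes lc: "label_closed (<) \<F>" and "\<F> \<noteq> {}"
    and chordal: "\<And>F G. \<lbrakk>F \<in> \<F>\<^sub>0; G \<in> \<F>\<^sub>0; F \<noteq> G; adjacent F G; max_label l F = max_label l G;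
      card (union_minus_max l F G) = s\<rbrakk> \<Longrightarrow> union_minus_max l F G \<in> \<F>\<^sub>0"
  shows "\<exists>R. face_dim R = int s - 2 \<and> simplicial 1 (generated \<F>) R \<and>
    label_closed (<) {G \<in> \<F>. \<not> R \<subseteq> G}"
proof -
  have sub: "\<F> \<subseteq> \<F>\<^sub>0" using lc by (simp add: label_closed_def)
  obtain v where v: "top_vertex \<F> v" using top_vertex_exists[OF sub assms(2)] .
  then obtain F\<^sub>v where F: "F\<^sub>v \<in> \<F>" "v \<in> F\<^sub>v" by (auto simp: top_vertex_def)
  then have "finite F\<^sub>v" "card F\<^sub>v = s" using sub uniform by auto
  \<comment> \<open>As \<open>s\<close> is at least 2, a set of size \<open>s - 1\<close> has room
    for \<open>v\<close>.\<close>
  then have "card {v} \<le> s - 1" "s - 1 \<le> card F\<^sub>v" "{v} \<subseteq> F\<^sub>v"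
    using F two_le_size by auto
  then obtain R where "{v} \<subseteq> R" and R: "R \<subseteq> F\<^sub>v" "card R = s - 1"
    using exists_subset_between \<open>finite F\<^sub>v\<close> by metis
  then have vR: "v \<in> R" by simp
  have "finite R" using R(1) \<open>finite F\<^sub>v\<close> finite_subset by blast
  have "simplicial 1 (generated \<F>) R"
  proof (rule one_simplicialI[OF sub F(1) R(1)])
    fix a b F G
    assume FG: "F \<in> \<F>" "G \<in> \<F>" "R \<subseteq> F" "R \<subseteq> G" "a \<in> F" "b \<in> G" "a \<notin> G" "b \<notin> F"
    have fin: "finite F" "finite G" "card F = s" "card G = s" using FG sub uniform by auto
    have ab: "a \<notin> R" "b \<notin> R" "a \<noteq> b" using FG by auto
    then have "card (insert a R) = s" "card (insert b R) = s"
      using R(2) \<open>finite R\<close> two_le_size by auto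
    then have shape: "insert a R = F" "insert b R = G"
      using FG fin by (metis card_subset_eq insert_subset)+
    then have "F \<inter> G = R" using ab by blast
    then have "adjacent F G"
      using fin R(2) two_le_size by (auto simp: adjacent_def face_dim_def of_nat_diff)
    moreover have "max_label l F = l v" "max_label l G = l v"
      using FG sub vR by (auto intro!: max_label_eq_top[OF v])
    moreover have eq: "union_minus_max l F G = F \<union> G - {v}"
      using FG vR by (intro union_minus_max_top[OF v]) auto
    \<comment> \<open>The \<open>s - 1\<close> vertices of \<open>R\<close> together with
      \<open>a\<close> and \<open>b\<close> number \<open>s + 1\<close>; removing \<open>v\<close>
      brings this back to the size of a facet.\<close>
    moreover have "card (F \<union> G - {v}) = s"
    proof -
      have "F \<union> G = insert a (insert b R)" using shape by blast
      then show ?thesis using ab R vR \<open>finite R\<close> two_le_size by simp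
    qed
    ultimately have "F \<union> G - {v} \<in> \<F>\<^sub>0"
      using chordal[of F G] FG sub by auto
    then have "F \<union> G - {v} \<in> \<F>"
      using label_closed_top[OF lc v] FG by blast
    moreover have "{a, b} \<subseteq> F \<union> G - {v}" using FG vR by auto
    ultimately show "\<exists>H\<in>\<F>. {a, b} \<subseteq> H" by blast
  qed
  moreover have "face_dim R = int s - 2"
    using R(2) two_le_size by (simp add: face_dim_def of_nat_diff)
  ultimately show ?thesis using label_closed_delete_face[OF lc v vR] by blast
qed

end

section \<open>Facets of pure complexes, and the conclusion\<close>

lemma complex_dim_void [simp]: "complex_dim {} = - 1"
  by (simp add: complex_dim_def)

lemma face_in_facet:
  assumes "simplicial_complex \<Delta>" "F \<in> \<Delta>"
  obtains G where "facet \<Delta> G" "F \<subseteq> G"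
proof -
  have "finite \<Delta>" using assms(1) by (simp add: simplicial_complex_def)
  from finite_has_maximal2[OF this assms(2)] that show ?thesis
    unfolding facet_def by metis
qed

text \<open>A face of top dimension lies in some facet, which by purity has the same size and hence
  equals it. Faces of size \<open>s\<close> obtained from chordality thus count as facets.\<close>

lemma pure_facet_iff:
  assumes "simplicial_complex \<Delta>" "pure \<Delta>"
  shows "facet \<Delta> F \<longleftrightarrow> F \<in> \<Delta> \<and> face_dim F = complex_dim \<Delta>"
proof
  assume "facet \<Delta> F"
  with assms(2) show "F \<in> \<Delta> \<and> face_dim F = complex_dim \<Delta>"
    by (simp add: pure_def facet_def)
next
  assume F: "F \<in> \<Delta> \<and> face_dim F = complex_dim \<Delta>"
  then obtain G where G: "facet \<Delta> G" "F \<subseteq> G" using face_in_facet assms(1) by blast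
  then have "card F = card G" "finite G"
    using F assms by (auto simp: pure_def face_dim_def facet_def simplicial_complex_def)
  with G show "facet \<Delta> F" using card_subset_eq by blast
qed

lemma generated_facets:
  assumes "simplicial_complex \<Delta>"
  shows "generated {F. facet \<Delta> F} = \<Delta>"
proof
  show "generated {F. facet \<Delta> F} \<subseteq> \<Delta>"
    using assms by (auto simp: generated_def facet_def simplicial_complex_def)
  show "\<Delta> \<subseteq> generated {F. facet \<Delta> F}"
    using face_in_facet[OF assms] unfolding generated_def by blast
qed

theorem theorem4:
  fixes \<Delta> :: "'a set set"
  assumes "simplicial_complex \<Delta>"
    and "pure \<Delta>"
    and "complex_dim \<Delta> \<ge> 1"
  shows "(E_chordal \<Delta> \<longrightarrow> vertex_chordal \<Delta>) \<and>
         (mid_chordal \<Delta> \<longrightarrow> weakly_vertex_chordal \<Delta>) \<and>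
         (very_weakly_chordal \<Delta> \<longrightarrow> weakly_ridge_chordal \<Delta>)"
proof -
  define \<F>\<^sub>0 where "\<F>\<^sub>0 = {F. facet \<Delta> F}"
  define s where "s = nat (complex_dim \<Delta> + 1)"
  have dim: "complex_dim \<Delta> = int s - 1" and s: "2 \<le> s" using assms(3) by (auto simp: s_def)
  have mem: "F \<in> \<F>\<^sub>0 \<longleftrightarrow> F \<in> \<Delta> \<and> card F = s" for F
    using pure_facet_iff[OF assms(1,2), of F] dim by (auto simp: \<F>\<^sub>0_def face_dim_def)
  have facet_mem: "facet \<Delta> F \<longleftrightarrow> F \<in> \<F>\<^sub>0" for F by (simp add: \<F>\<^sub>0_def)
  have gen: "generated \<F>\<^sub>0 = \<Delta>" using generated_facets[OF assms(1)] by (simp add: \<F>\<^sub>0_def)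
  have unif: "finite F \<and> card F = s" if "F \<in> \<F>\<^sub>0" for F
    using that mem assms(1) by (auto simp: simplicial_complex_def)
  have fin: "finite \<F>\<^sub>0"
    using assms(1) mem by (auto simp: simplicial_complex_def intro: finite_subset[of \<F>\<^sub>0 \<Delta>])
  have family: "labeled_uniform_family \<F>\<^sub>0 s l" if "labeling \<Delta> l" for l
  proof
    have "\<Union>\<F>\<^sub>0 \<subseteq> vertices \<Delta>" using mem by (auto simp: vertices_def)
    then show "inj_on l (\<Union>\<F>\<^sub>0)"
      using that unfolding labeling_def bij_betw_def by (blast intro: inj_on_subset)
  qed (use fin unif s in auto)
  have "vertex_chordal \<Delta>" if "E_chordal \<Delta>"
  proof -
    from that obtain l where l: "labeling \<Delta> l"
      and ch: "\<And>F G H. \<lbrakk>F \<in> \<F>\<^sub>0; G \<in> \<F>\<^sub>0; F \<noteq> G; max_label l F = max_label l G;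
        H \<subseteq> F \<union> G; card H = s\<rbrakk> \<Longrightarrow> H \<in> \<F>\<^sub>0"
      unfolding E_chordal_def facet_mem by (metis mem)
    interpret labeled_uniform_family \<F>\<^sub>0 s l by (rule family[OF l])
    have "(deletion_step 0 (int s - 1))\<^sup>*\<^sup>* (generated \<F>\<^sub>0) {}"
    proof (rule generated_reduces_to_void[where P = "label_closed (\<le>)"])
      show "label_closed (\<le>) \<F>\<^sub>0" by (simp add: label_closed_def)
      show "\<exists>R. face_dim R = 0 \<and> simplicial (int s - 1) (generated \<G>) R \<and>
          label_closed (\<le>) {G \<in> \<G>. \<not> R \<subseteq> G}"
        if "label_closed (\<le>) \<G>" "\<G> \<noteq> {}" for \<G>
        by (rule E_chordal_step[OF that]) (rule ch)
    qed (use fin unif in auto)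
    \<comment> \<open>The reduction ends at the void complex, whose dimension -1 is below the
      required bound 0.\<close>
    then show ?thesis
      unfolding gen vertex_chordal_def face_chordal_def dim using s
      by (auto intro!: exI[of _ "{}"])
  qed
  moreover have "weakly_vertex_chordal \<Delta>" if "mid_chordal \<Delta>"
  proof -
    from that obtain l where l: "labeling \<Delta> l"
      and ch: "\<And>F G e. \<lbrakk>F \<in> \<F>\<^sub>0; G \<in> \<F>\<^sub>0; F \<noteq> G; max_label l F = max_label l G;
        e \<subseteq> union_minus_max l F G; card e = 2\<rbrakk> \<Longrightarrow>
        \<exists>H\<in>\<F>\<^sub>0. e \<subseteq> H \<and> H \<subseteq> union_minus_max l F G"
      unfolding mid_chordal_def facet_mem by (metis mem)
    interpret labeled_uniform_family \<F>\<^sub>0 s l by (rule family[OF l])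
    have "(deletion_step 0 1)\<^sup>*\<^sup>* (generated \<F>\<^sub>0) {}"
    proof (rule generated_reduces_to_void[where P = "label_closed (\<le>)"])
      show "label_closed (\<le>) \<F>\<^sub>0" by (simp add: label_closed_def)
      show "\<exists>R. face_dim R = 0 \<and> simplicial 1 (generated \<G>) R \<and>
          label_closed (\<le>) {G \<in> \<G>. \<not> R \<subseteq> G}"
        if "label_closed (\<le>) \<G>" "\<G> \<noteq> {}" for \<G>
        by (rule mid_chordal_step[OF that]) (rule ch)
    qed (use fin unif in auto)
    then show ?thesis
      unfolding gen weakly_vertex_chordal_def weakly_face_chordal_def dim using s
      by (auto intro!: exI[of _ "{}"])
  qed
  moreover have "weakly_ridge_chordal \<Delta>" if "very_weakly_chordal \<Delta>"
  proof -
    from that obtain l where l: "labeling \<Delta> l"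
      and ch: "\<And>F G. \<lbrakk>F \<in> \<F>\<^sub>0; G \<in> \<F>\<^sub>0; F \<noteq> G; adjacent F G; max_label l F = max_label l G;
        card (union_minus_max l F G) = s\<rbrakk> \<Longrightarrow> union_minus_max l F G \<in> \<F>\<^sub>0"
      unfolding very_weakly_chordal_def facet_mem by (metis mem)
    interpret labeled_uniform_family \<F>\<^sub>0 s l by (rule family[OF l])
    \<comment> \<open>A ridge has dimension d - 1, which is \<open>int s - 2\<close>.\<close>
    have "(deletion_step (int s - 2) 1)\<^sup>*\<^sup>* (generated \<F>\<^sub>0) {}"
    proof (rule generated_reduces_to_void[where P = "label_closed (<)"])
      show "label_closed (<) \<F>\<^sub>0" by (simp add: label_closed_def)
      show "\<exists>R. face_dim R = int s - 2 \<and> simplicial 1 (generated \<G>) R \<and>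
          label_closed (<) {G \<in> \<G>. \<not> R \<subseteq> G}"
        if "label_closed (<) \<G>" "\<G> \<noteq> {}" for \<G>
        by (rule very_weakly_chordal_step[OF that]) (rule ch)
    qed (use fin unif in auto)
    then show ?thesis
      unfolding gen weakly_ridge_chordal_def weakly_face_chordal_def dim using s
      by (auto intro!: exI[of _ "{}"])
  qed
  ultimately show ?thesis by blast
qed

end
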